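(* Let $G$ be a finite weighted graph with vertex set $V$ and graph Laplacian $\mathcal{L}$. For every subset of vertices $U\subset V$, every $k\in\mathbb{N}$ and every $\varepsilon>0$, there exists a set of weights $\theta_u=\theta_u(U,k,\varepsilon)$, $u\in U$, namely $\theta_u=\sum_{v\in V}L^{U,u}_{k,\varepsilon}(v)$, such that for every variational spline $Y^{U,y}_{k,\varepsilon}$ that takes the values $Y^{U,y}_{k,\varepsilon}(u)=y_u$, $u\in U$, the following exact formula holds: $$\sum_{v\in V}Y^{U,y}_{k,\varepsilon}(v)=\sum_{u\in U}y_u\theta_u .$$
   Context: $G$ is an undirected weighted graph with finite vertex set $V=V(G)$ and symmetric weight function $w:V\times V\to[0,\infty)$, $w(u,v)=w(v,u)$, $w(u,u)=0$; pairs with $w(u,v)\neq0$ are edges. $L_2(G)$ is the space of real-valued functions on $V$ with inner product $\langle f,g\rangle=\sum_{v\in V}f(v)g(v)$ and norm $\|f\|=\left(\sum_{v\in V}|f(v)|^2\right)^{1/2}$. The Laplacian is $(\mathcal{L}f)(v)=\sum_{u\in V}(f(v)-f(u))w(v,u)$, a positive-semidefinite self-adjoint operator on $L_2(G)$. Variational splines: given $U\subset V$, $k\in\mathbb{N}$, $\varepsilon>0$ and real numbers $y=\{y_u\}_{u\in U}$, the variational spline $Y^{U,y}_{k,\varepsilon}$ is the unique function $Y\in L_2(G)$ with $Y(u)=y_u$ for all $u\in U$ which minimizes $\|(\varepsilon I+\mathcal{L})^kY\|$ among all functions satisfying these interpolation constraints. For $u\in U$, the Lagrangian spline $L^{U,u}_{k,\varepsilon}$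 is the variational spline with the constraints $L^{U,u}_{k,\varepsilon}(v)=\delta_{u,v}$ (Kronecker delta) for $v\in U$. *)

theory Defs
  imports "HOL-Analysis.Analysis"
begin

text \<open>
  The vertex set is the universe of a finite type \<^typ>\<open>'v\<close>, and \<open>L\<^sub>2(G)\<close> is \<open>real ^ 'v\<close>, whose library
  norm and inner product are the ones of \<open>L\<^sub>2(G)\<close>. The graph is given by its weight function; a pair
  of vertices with nonzero weight is an edge.
\<close>

definition weighted_graph :: "('v::finite \<Rightarrow> 'v \<Rightarrow> real) \<Rightarrow> bool" where
  "weighted_graph w \<longleftrightarrow>
     (\<forall>u v. 0 \<le> w u v) \<and> (\<forall>u v. w u v = w v u) \<and> (\<forall>u. w u u = 0)"

definition laplacian :: "('v::finite \<Rightarrow> 'v \<Rightarrow> real) \<Rightarrow> real ^ 'v \<Rightarrow> real ^ 'v" where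
  "laplacian w f = (\<chi> v. \<Sum>u\<in>UNIV. (f $ v - f $ u) * w v u)"

definition shifted_laplacian :: "('v::finite \<Rightarrow> 'v \<Rightarrow> real) \<Rightarrow> real \<Rightarrow> real ^ 'v \<Rightarrow> real ^ 'v" where
  "shifted_laplacian w \<epsilon> f = \<epsilon> *\<^sub>R f + laplacian w f"

text \<open>The data \<open>y\<close> is a family indexed by \<open>U\<close>; its values outside \<open>U\<close> are never used.\<close>

definition interpolates :: "'v::finite set \<Rightarrow> ('v \<Rightarrow> real) \<Rightarrow> real ^ 'v \<Rightarrow> bool" where
  "interpolates U y Y \<longleftrightarrow> (\<forall>u\<in>U. Y $ u = y u)"

definition is_variational_spline ::
  "('v::finite \<Rightarrow> 'v \<Rightarrow> real) \<Rightarrow> nat \<Rightarrow> real \<Rightarrow> 'v set \<Rightarrow> ('v \<Rightarrow> real) \<Rightarrow> real ^ 'v \<Rightarrow> bool" where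
  "is_variational_spline w k \<epsilon> U y Y \<longleftrightarrow>
     interpolates U y Y \<and>
     (\<forall>Z. interpolates U y Z \<longrightarrow>
        norm ((shifted_laplacian w \<epsilon> ^^ k) Y) \<le> norm ((shifted_laplacian w \<epsilon> ^^ k) Z))"

text \<open>
  For a weighted graph and \<open>\<epsilon> > 0\<close> the minimizer exists and is unique, because
  \<open>\<epsilon>I + \<L>\<close> is positive definite; so the description below is then proper.
\<close>

definition variational_spline ::
  "('v::finite \<Rightarrow> 'v \<Rightarrow> real) \<Rightarrow> nat \<Rightarrow> real \<Rightarrow> 'v set \<Rightarrow> ('v \<Rightarrow> real) \<Rightarrow> real ^ 'v" where
  "variational_spline w k \<epsilon> U y = (THE Y. is_variational_spline w k \<epsilon> U y Y)"

definition lagrangian_spline ::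
  "('v::finite \<Rightarrow> 'v \<Rightarrow> real) \<Rightarrow> nat \<Rightarrow> real \<Rightarrow> 'v set \<Rightarrow> 'v \<Rightarrow> real ^ 'v" where
  "lagrangian_spline w k \<epsilon> U u = variational_spline w k \<epsilon> U (\<lambda>v. if v = u then 1 else 0)"

end

theory Submission
  imports Defs
begin

text \<open>
  Write \<open>T\<close> for the \<open>k\<close>-th power of \<open>\<epsilon>I + \<L>\<close>. The Laplacian is positive semidefinite, so \<open>T\<close> is
  linear and injective. A function \<open>Y\<close> with the prescribed values on \<open>U\<close> competes exactly with the
  functions \<open>Y + z\<close>, where \<open>z\<close> vanishes on \<open>U\<close>, so minimizing \<open>\<parallel>T Y\<parallel>\<close> is a least squares problem: if
  \<open>T Y\<close> is orthogonal to \<open>T z\<close> for all such \<open>z\<close>, then by Pythagoras \<open>Y\<close> is the one and only spline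
  (\<open>variational_spline_eqI\<close>). Such a \<open>Y\<close> exists for all data, by orthogonal projection onto the
  image under \<open>T\<close> of the functions that vanish on \<open>U\<close> (\<open>orthogonal_interpolant_exists\<close>).

  The orthogonality condition is linear in \<open>Y\<close>. Therefore the combination of the Lagrangian
  splines with coefficients \<open>y u\<close>, which takes the value \<open>y u\<close> at each \<open>u \<in> U\<close>, satisfies it too and
  is the spline with data \<open>y\<close>. Summing its values over all vertices gives the formula.
\<close>

lemma linear_shifted_laplacian: "linear (shifted_laplacian w \<epsilon>)"
proof (rule linearI)
  show "shifted_laplacian w \<epsilon> (f + g) = shifted_laplacian w \<epsilon> f + shifted_laplacian w \<epsilon> g" for f g
    by (simp add: shifted_laplacian_def laplacian_def vec_eq_iff algebra_simps
        sum.distrib sum_subtractf)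
  show "shifted_laplacian w \<epsilon> (c *\<^sub>R f) = c *\<^sub>R shifted_laplacian w \<epsilon> f" for c f
    by (simp add: shifted_laplacian_def laplacian_def vec_eq_iff algebra_simps
        sum_distrib_left sum_subtractf)
qed

text \<open>
  Exchanging the two summation vertices and averaging turns \<open>f \<bullet> \<L> f\<close> into half of the sum
  of \<open>(f v - f u)\<^sup>2 w v u\<close> over all ordered pairs of vertices.
\<close>

lemma laplacian_nonneg:
  assumes "weighted_graph w"
  shows "0 \<le> f \<bullet> laplacian w f"
proof -
  have nonneg: "0 \<le> w u v" and sym: "w u v = w v u" for u v
    using assms by (auto simp: weighted_graph_def)
  define S where "S = (\<Sum>v\<in>UNIV. \<Sum>u\<in>UNIV. f $ v * ((f $ v - f $ u) * w v u))"
  have S: "f \<bullet> laplacian w f = S"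
    by (simp add: S_def inner_vec_def laplacian_def sum_distrib_left)
  have "S = (\<Sum>v\<in>UNIV. \<Sum>u\<in>UNIV. f $ u * ((f $ u - f $ v) * w u v))"
    unfolding S_def by (rule sum.swap)
  then have "2 * S = S + (\<Sum>v\<in>UNIV. \<Sum>u\<in>UNIV. f $ u * ((f $ u - f $ v) * w u v))"
    by simp
  also have "\<dots> = (\<Sum>v\<in>UNIV. \<Sum>u\<in>UNIV. (f $ v - f $ u)\<^sup>2 * w v u)"
    unfolding S_def sum.distrib [symmetric]
    by (intro sum.cong refl) (subst sym, simp add: power2_eq_square algebra_simps sym)
  also have "\<dots> \<ge> 0"
    by (intro sum_nonneg mult_nonneg_nonneg nonneg) auto
  finally show ?thesis
    using S by simp
qed

lemma inj_shifted_laplacian: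
  assumes "weighted_graph w" and "\<epsilon> > 0"
  shows "inj (shifted_laplacian w \<epsilon>)"
  unfolding linear_injective_0 [OF linear_shifted_laplacian]
proof (intro allI impI)
  fix f assume "shifted_laplacian w \<epsilon> f = 0"
  then have "\<epsilon> * (f \<bullet> f) + f \<bullet> laplacian w f = 0"
    by (metis inner_add_right inner_scaleR_right inner_zero_right shifted_laplacian_def)
  with laplacian_nonneg [OF assms(1), of f] have "\<epsilon> * (f \<bullet> f) \<le> 0"
    by simp
  with assms(2) show "f = 0"
    by (metis inner_gt_zero_iff mult_pos_pos not_less)
qed

lemma linear_funpow:
  fixes A :: "'a::real_vector \<Rightarrow> 'a"
  assumes "linear A"
  shows "linear (A ^^ k)"
  by (induction k) (simp_all only: funpow.simps linear_id linear_compose assms)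

text \<open>
  These are the normal equations of the least squares problem. The test functions \<open>z\<close>, which
  interpolate the zero data, are the differences of two competitors.
\<close>

definition orthogonal_interpolant ::
  "(real ^ 'v \<Rightarrow> real ^ 'v) \<Rightarrow> 'v::finite set \<Rightarrow> ('v \<Rightarrow> real) \<Rightarrow> real ^ 'v \<Rightarrow> bool" where
  "orthogonal_interpolant T U y Y \<longleftrightarrow>
     interpolates U y Y \<and> (\<forall>z. interpolates U (\<lambda>_. 0) z \<longrightarrow> T Y \<bullet> T z = 0)"

text \<open>
  Start from any interpolant and remove from its image under \<open>T\<close> the orthogonal projection onto the
  images of the functions vanishing on \<open>U\<close>; this changes the interpolant by such a function only.
\<close>

lemma orthogonal_interpolant_exists:
  fixes T :: "real ^ 'v::finite \<Rightarrow> real ^ 'v"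
  assumes "linear T"
  obtains Y where "orthogonal_interpolant T U y Y"
proof -
  define S where "S = {z. interpolates U (\<lambda>_. 0) z}"
  have "subspace S"
    by (auto simp: S_def interpolates_def subspace_def)
  then have sub: "subspace (T ` S)"
    using assms linear_subspace_image by blast
  define Z :: "real ^ 'v" where "Z = (\<chi> v. y v)"
  obtain p q where p: "p \<in> span (T ` S)" and q: "\<And>x. x \<in> span (T ` S) \<Longrightarrow> orthogonal q x"
    and Z: "T Z = p + q"
    using orthogonal_subspace_decomp_exists [of "T ` S" "T Z"] by metis
  from p sub obtain s where s: "s \<in> S" "p = T s"
    by (auto simp: span_eq_iff [THEN iffD2])
  have "interpolates U y (Z - s)"
    using s(1) by (simp add: S_def Z_def interpolates_def)
  moreover have "T (Z - s) \<bullet> T z = 0" if "interpolates U (\<lambda>_. 0) z" for z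
  proof -
    have "T (Z - s) = q"
      using Z s(2) by (simp add: linear_diff [OF assms])
    moreover have "T z \<in> span (T ` S)"
      using that by (simp add: S_def span_base)
    ultimately show ?thesis
      using q by (simp add: orthogonal_def)
  qed
  ultimately show thesis
    using that by (auto simp: orthogonal_interpolant_def)
qed

text \<open>
  Pythagoras: \<open>\<parallel>T Z\<parallel>\<^sup>2 = \<parallel>T Y\<parallel>\<^sup>2 + \<parallel>T (Z - Y)\<parallel>\<^sup>2\<close> for every competitor \<open>Z\<close>. Hence \<open>Y\<close> is a minimizer, and
  a second minimizer \<open>Z\<close> has \<open>T (Z - Y) = 0\<close>, so it equals \<open>Y\<close> because \<open>T\<close> is injective.
\<close>

lemma variational_spline_eqI:
  assumes "weighted_graph w" and "\<epsilon> > 0"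
    and Y: "orthogonal_interpolant (shifted_laplacian w \<epsilon> ^^ k) U y Y"
  shows "variational_spline w k \<epsilon> U y = Y"
proof -
  define T where "T = shifted_laplacian w \<epsilon> ^^ k"
  have lin: "linear T"
    by (simp add: T_def linear_funpow linear_shifted_laplacian)
  have inj: "inj T"
    by (simp add: T_def inj_fn inj_shifted_laplacian assms)
  have pythagoras: "(norm (T Z))\<^sup>2 = (norm (T Y))\<^sup>2 + (norm (T (Z - Y)))\<^sup>2"
    if "interpolates U y Z" for Z
  proof -
    have "interpolates U (\<lambda>_. 0) (Z - Y)"
      using Y that by (simp add: interpolates_def orthogonal_interpolant_def)
    then have "orthogonal (T Y) (T (Z - Y))"
      using Y by (simp add: orthogonal_interpolant_def orthogonal_def T_def)
    then have "(norm (T Y + T (Z - Y)))\<^sup>2 = (norm (T Y))\<^sup>2 + (norm (T (Z - Y)))\<^sup>2"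
      by (rule norm_add_Pythagorean)
    then show ?thesis
      by (simp add: linear_diff [OF lin])
  qed
  show ?thesis
    unfolding variational_spline_def is_variational_spline_def T_def [symmetric]
  proof (rule the_equality)
    have "norm (T Y) \<le> norm (T Z)" if "interpolates U y Z" for Z
      using pythagoras [OF that] by (simp add: power2_le_imp_le)
    then show "interpolates U y Y \<and> (\<forall>Z. interpolates U y Z \<longrightarrow> norm (T Y) \<le> norm (T Z))"
      using Y by (simp add: orthogonal_interpolant_def)
  next
    fix Z
    assume Z: "interpolates U y Z \<and> (\<forall>X. interpolates U y X \<longrightarrow> norm (T Z) \<le> norm (T X))"
    then have "norm (T Z) \<le> norm (T Y)"
      using Y by (simp add: orthogonal_interpolant_def)
    then have "(norm (T Z))\<^sup>2 \<le> (norm (T Y))\<^sup>2"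
      by (simp add: power_mono)
    with pythagoras [of Z] Z have "T (Z - Y) = 0"
      by simp
    then have "T Z = T Y"
      by (simp add: linear_diff [OF lin])
    with inj show "Z = Y"
      by (simp add: inj_eq)
  qed
qed

lemma variational_spline_orthogonal:
  assumes "weighted_graph w" and "\<epsilon> > 0"
  shows "orthogonal_interpolant (shifted_laplacian w \<epsilon> ^^ k) U y (variational_spline w k \<epsilon> U y)"
  by (metis assms linear_funpow linear_shifted_laplacian orthogonal_interpolant_exists
      variational_spline_eqI)

lemma variational_spline_eq_sum_lagrangian:
  assumes "weighted_graph w" and "\<epsilon> > 0"
  shows "variational_spline w k \<epsilon> U y = (\<Sum>u\<in>U. y u *\<^sub>R lagrangian_spline w k \<epsilon> U u)"
    (is "_ = ?Y")
proof (rule variational_spline_eqI [OF assms])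
  define T where "T = shifted_laplacian w \<epsilon> ^^ k"
  have lin: "linear T"
    by (simp add: T_def linear_funpow linear_shifted_laplacian)
  have L: "orthogonal_interpolant T U (\<lambda>v. if v = u then 1 else 0) (lagrangian_spline w k \<epsilon> U u)"
    for u
    unfolding T_def lagrangian_spline_def by (rule variational_spline_orthogonal [OF assms])
  have "interpolates U y ?Y"
    unfolding interpolates_def
  proof
    fix v assume v: "v \<in> U"
    have "?Y $ v = (\<Sum>u\<in>U. y u * (if v = u then 1 else 0))"
      using L v by (simp add: orthogonal_interpolant_def interpolates_def)
    also have "\<dots> = y v"
      using v by (simp add: if_distrib cong: if_cong)
    finally show "?Y $ v = y v" .
  qed
  moreover have "T ?Y \<bullet> T z = 0" if "interpolates U (\<lambda>_. 0) z" for z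
    using L that
    by (simp add: linear_sum [OF lin] linear_scale [OF lin] inner_sum_left
        orthogonal_interpolant_def)
  ultimately show "orthogonal_interpolant (shifted_laplacian w \<epsilon> ^^ k) U y ?Y"
    by (simp add: orthogonal_interpolant_def T_def)
qed

theorem theorem3p1:
  fixes w :: "'v::finite \<Rightarrow> 'v \<Rightarrow> real" and U :: "'v set" and k :: nat and \<epsilon> :: real
  assumes "weighted_graph w" and "\<epsilon> > 0"
  shows "\<exists>\<theta> :: 'v \<Rightarrow> real.
           (\<forall>u\<in>U. \<theta> u = (\<Sum>v\<in>UNIV. lagrangian_spline w k \<epsilon> U u $ v)) \<and>
           (\<forall>y :: 'v \<Rightarrow> real.
              (\<Sum>v\<in>UNIV. variational_spline w k \<epsilon> U y $ v) = (\<Sum>u\<in>U. y u * \<theta> u))"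
proof (intro exI conjI ballI allI)
  show "(\<Sum>v\<in>UNIV. lagrangian_spline w k \<epsilon> U u $ v)
      = (\<Sum>v\<in>UNIV. lagrangian_spline w k \<epsilon> U u $ v)" for u ..
  fix y :: "'v \<Rightarrow> real"
  have "(\<Sum>v\<in>UNIV. variational_spline w k \<epsilon> U y $ v)
      = (\<Sum>v\<in>UNIV. \<Sum>u\<in>U. y u * lagrangian_spline w k \<epsilon> U u $ v)"
    by (simp add: variational_spline_eq_sum_lagrangian [OF assms])
  also have "\<dots> = (\<Sum>u\<in>U. \<Sum>v\<in>UNIV. y u * lagrangian_spline w k \<epsilon> U u $ v)"
    by (rule sum.swap)
  finally show "(\<Sum>v\<in>UNIV. variational_spline w k \<epsilon> U y $ v)
      = (\<Sum>u\<in>U. y u * (\<Sum>v\<in>UNIV. lagrangian_spline w k \<epsilon> U u $ v))"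
    by (simp add: sum_distrib_left)
qed

end
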